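(* Let $f$ be an everywhere differentiable mapping from an open subset of $\mathbb{R}^q$ into $\mathbb{R}^q$. Suppose that for some $\theta_0\in\mathbb{R}^q$ with $\nabla f(\theta_0)$ non-singular, some $L\ge 0$ and some $\alpha\in(0,1]$, $$\|[\nabla f(\theta_0)]^{-1}(\nabla f(\theta_0)-\nabla f(\theta))\|_{op}\le L\|\theta-\theta_0\|_2^{\alpha}\quad\text{whenever }(3L)^{1/\alpha}\|\theta-\theta_0\|_2\le 1$$ (all such $\theta$ lying in the domain of $f$), and $$\|[\nabla f(\theta_0)]^{-1}f(\theta_0)\|_2\le\frac{2}{3(3L)^{1/\alpha}}.$$ Then there exists a unique solution $\theta^\star$ of $f(\theta)=0$ in $B\big(\theta_0,\,1.5\|[\nabla f(\theta_0)]^{-1}f(\theta_0)\|_2\big)$, and this solution satisfies $$\big\|\theta^\star-\theta_0+[\nabla f(\theta_0)]^{-1}f(\theta_0)\big\|_2\le(1.5)^{1+\alpha}L\,\big\|[\nabla f(\theta_0)]^{-1}f(\theta_0)\big\|_2^{1+\alpha}.$$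
   Context: $B(\theta_0,r):=\{\theta\in\mathbb{R}^q:\|\theta-\theta_0\|_2\le r\}$ is the closed Euclidean ball. $\|\cdot\|_{op}$ is the matrix operator norm induced by the Euclidean norm. $\nabla f(\theta)\in\mathbb{R}^{q\times q}$ is the derivative (Jacobian matrix) of $f$ at $\theta$. When $L=0$ the right-hand side $2/(3(3L)^{1/\alpha})$ is read as $+\infty$. *)

theory Defs
  imports "HOL-Analysis.Analysis"
begin

end

theory Submission
  imports Defs
begin

text \<open>The simplified Newton map \<open>g \<theta> = \<theta> - A f(\<theta>)\<close>, with \<open>A\<close> the inverse Jacobian at
  \<open>\<theta>\<^sub>0\<close>, has derivative \<open>A (\<nabla>f(\<theta>\<^sub>0) - \<nabla>f(\<theta>))\<close>. On the ball of radius \<open>R = 3/2 |A f(\<theta>\<^sub>0)|\<close>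
  this has norm at most \<open>L R\<^sup>\<alpha> \<le> 1/3\<close>, so \<open>g\<close> is a contraction there; it maps the ball into itself
  because \<open>R/3 + 2R/3 = R\<close>. Its fixed points are the zeros of \<open>f\<close>, and the error bound is the
  Lipschitz estimate between the fixed point and \<open>\<theta>\<^sub>0\<close>.\<close>

text \<open>The bound on the displacement of the centre leaves exactly the room that the contraction
  needs: a point of the ball is sent to within \<open>c * R + (1 - c) * R\<close>, that is
  \<open>R\<close>, of \<open>a\<close>. Banach's theorem then applies on the closed, hence
  complete, ball.\<close>

lemma ex1_fixpoint_cball:
  fixes g :: "'a::{real_normed_vector, complete_space} \<Rightarrow> 'a"
  assumes c: "0 \<le> c" "c < 1"
    and lip: "\<And>x y. x \<in> cball a R \<Longrightarrow> y \<in> cball a R \<Longrightarrow> norm (g x - g y) \<le> c * norm (x - y)"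
    and start: "norm (g a - a) \<le> (1 - c) * R"
  shows "\<exists>!x\<in>cball a R. g x = x"
proof -
  \<comment> \<open>The sign of \<open>R\<close> is forced by \<open>start\<close>; it puts
    \<open>a\<close> in the ball, which is therefore nonempty.\<close>
  have "0 \<le> (1 - c) * R" using start norm_ge_zero order_trans by blast
  with c have R: "0 \<le> R" by (simp add: zero_le_mult_iff)
  have "g ` cball a R \<subseteq> cball a R"
  proof clarify
    fix x assume x: "x \<in> cball a R"
    have "norm (g x - a) \<le> norm (g x - g a) + norm (g a - a)"
      by (metis diff_add_cancel add_diff_eq norm_triangle_ineq)
    also have "\<dots> \<le> c * norm (x - a) + (1 - c) * R"
      using lip[OF x, of a] R start by (simp add: add_mono)
    also have "\<dots> \<le> c * R + (1 - c) * R"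
      using x c by (intro add_right_mono mult_left_mono) (auto simp: dist_norm norm_minus_commute)
    finally show "g x \<in> cball a R"
      by (simp add: dist_norm norm_minus_commute algebra_simps)
  qed
  then show ?thesis
    using c R lip by (intro Banach_fix[where c = c]) (auto simp: complete_eq_closed dist_norm)
qed

lemma matrix_inv_left_right:
  fixes J :: "real^'n^'n"
  assumes "invertible J"
  shows "J ** matrix_inv J = mat 1" "matrix_inv J ** J = mat 1"
  using someI_ex[OF assms[unfolded invertible_def]] by (auto simp: matrix_inv_def)

lemma matrix_inv_mult_vec_eq_0_iff:
  fixes J :: "real^'n^'n"
  assumes "invertible J"
  shows "matrix_inv J *v x = 0 \<longleftrightarrow> x = 0"
proof
  assume "matrix_inv J *v x = 0"
  then have "(J ** matrix_inv J) *v x = 0"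
    by (simp add: matrix_vector_mul_assoc[symmetric])
  then show "x = 0" using assms by (simp add: matrix_inv_left_right)
qed simp

theorem theorem2p2:
  fixes f :: "real^'q \<Rightarrow> real^'q"
    and \<Omega> :: "(real^'q) set"
    and \<theta>\<^sub>0 :: "real^'q"
    and L \<alpha> :: real
  assumes "open \<Omega>"
    and "\<forall>\<theta>\<in>\<Omega>. f differentiable (at \<theta>)"
    and "\<theta>\<^sub>0 \<in> \<Omega>"
    and "invertible (jacobian f (at \<theta>\<^sub>0))"
    and "L \<ge> 0"
    and "0 < \<alpha>" and "\<alpha> \<le> 1"
    and "\<forall>\<theta>. (3 * L) powr (1 / \<alpha>) * norm (\<theta> - \<theta>\<^sub>0) \<le> 1 \<longrightarrow>
           \<theta> \<in> \<Omega> \<and>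
           onorm ((*v) (matrix_inv (jacobian f (at \<theta>\<^sub>0))
                        ** (jacobian f (at \<theta>\<^sub>0) - jacobian f (at \<theta>))))
             \<le> L * norm (\<theta> - \<theta>\<^sub>0) powr \<alpha>"
    and "L \<noteq> 0 \<longrightarrow>
           norm (matrix_inv (jacobian f (at \<theta>\<^sub>0)) *v f \<theta>\<^sub>0) \<le> 2 / (3 * (3 * L) powr (1 / \<alpha>))"
  shows "\<exists>\<theta>\<^sub>s. (\<theta>\<^sub>s \<in> \<Omega> \<inter> cball \<theta>\<^sub>0 (3/2 * norm (matrix_inv (jacobian f (at \<theta>\<^sub>0)) *v f \<theta>\<^sub>0)) \<and> f \<theta>\<^sub>s = 0) \<and>
           (\<forall>\<theta>. \<theta> \<in> \<Omega> \<inter> cball \<theta>\<^sub>0 (3/2 * norm (matrix_inv (jacobian f (at \<theta>\<^sub>0)) *v f \<theta>\<^sub>0)) \<and> f \<theta> = 0 \<longrightarrow> \<theta> = \<theta>\<^sub>s) \<and>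
           norm (\<theta>\<^sub>s - \<theta>\<^sub>0 + matrix_inv (jacobian f (at \<theta>\<^sub>0)) *v f \<theta>\<^sub>0)
             \<le> (3/2) powr (1 + \<alpha>) * L * norm (matrix_inv (jacobian f (at \<theta>\<^sub>0)) *v f \<theta>\<^sub>0) powr (1 + \<alpha>)"
proof -
  define A where "A = matrix_inv (jacobian f (at \<theta>\<^sub>0))"
  define r where "r = norm (A *v f \<theta>\<^sub>0)"
  define R where "R = 3/2 * r"
  define g where "g = (\<lambda>\<theta>. \<theta> - A *v f \<theta>)"
  let ?B = "cball \<theta>\<^sub>0 R"
  have R0: "0 \<le> R" by (simp add: R_def r_def)
  have R1: "(3 * L) powr (1 / \<alpha>) * R \<le> 1"
  \<comment> \<open>For \<open>L = 0\<close> the factor is \<open>0 powr (1 / \<alpha>)\<close>,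
    which is 0, so any radius is admissible. Otherwise the 3/2 in \<open>R\<close> cancels the 2/3
    in the bound on \<open>r\<close>.\<close>
  proof (cases "L = 0")
    case False
    with assms(5) have "0 < (3 * L) powr (1 / \<alpha>)" by simp
    with assms(9) False show ?thesis
      by (simp add: R_def r_def A_def field_simps)
  qed simp
  \<comment> \<open>Raising to the power \<alpha> undoes the exponent \<open>1 / \<alpha>\<close>
    and gives the contraction constant.\<close>
  have "((3 * L) powr (1 / \<alpha>) * R) powr \<alpha> \<le> 1 powr \<alpha>"
    using R1 R0 assms(6) by (intro powr_mono2) auto
  moreover have "((3 * L) powr (1 / \<alpha>) * R) powr \<alpha> = 3 * L * R powr \<alpha>"
    using R0 assms(5,6) by (simp add: powr_mult powr_powr)
  ultimately have third: "L * R powr \<alpha> \<le> 1/3" by simp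
  have ball: "\<theta> \<in> \<Omega> \<and> onorm ((*v) (A ** (jacobian f (at \<theta>\<^sub>0) - jacobian f (at \<theta>)))) \<le> L * R powr \<alpha>"
    if "\<theta> \<in> ?B" for \<theta>
  proof -
    have n: "norm (\<theta> - \<theta>\<^sub>0) \<le> R" using that by (simp add: dist_norm norm_minus_commute)
    have "(3 * L) powr (1 / \<alpha>) * norm (\<theta> - \<theta>\<^sub>0) \<le> 1"
      using R1 n by (meson mult_left_mono order_trans powr_ge_zero)
    moreover have "L * norm (\<theta> - \<theta>\<^sub>0) powr \<alpha> \<le> L * R powr \<alpha>"
      using n assms(5,6) by (intro mult_left_mono powr_mono2) auto
    ultimately show ?thesis using assms(8) unfolding A_def by force
  qed
  \<comment> \<open>Mean value inequality on the convex ball. The constant is not yet weakened to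
    1/3, because the final error estimate needs this sharper form.\<close>
  have lip: "norm (g x - g y) \<le> L * R powr \<alpha> * norm (x - y)" if "x \<in> ?B" "y \<in> ?B" for x y
  proof (rule differentiable_bound[OF convex_cball _ _ that])
    fix \<theta> assume \<theta>: "\<theta> \<in> ?B"
    let ?D = "A ** (jacobian f (at \<theta>\<^sub>0) - jacobian f (at \<theta>))"
    have "(f has_derivative (*v) (jacobian f (at \<theta>))) (at \<theta>)"
      using assms(2) ball[OF \<theta>] jacobian_works by blast
    then have "(g has_derivative (\<lambda>h. h - A *v (jacobian f (at \<theta>) *v h))) (at \<theta>)"
      unfolding g_def
      by (intro has_derivative_diff has_derivative_ident
          bounded_linear.has_derivative[OF matrix_vector_mul_bounded_linear])
    \<comment> \<open>As \<open>A\<close> inverts the Jacobian at \<open>\<theta>\<^sub>0\<close>,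
      the bare \<open>h\<close> equals
      \<open>A *v (jacobian f (at \<theta>\<^sub>0) *v h)\<close>.\<close>
    moreover have "(\<lambda>h. h - A *v (jacobian f (at \<theta>) *v h)) = (*v) ?D"
      using matrix_inv_left_right(2)[OF assms(4)]
      by (simp add: fun_eq_iff A_def matrix_vector_mult_diff_rdistrib matrix_vector_mult_diff_distrib
          matrix_vector_mul_assoc flip: matrix_vector_mul_assoc[of _ "_ - _"])
    ultimately show "(g has_derivative (*v) ?D) (at \<theta> within ?B)"
      by (simp add: has_derivative_at_withinI)
    show "onorm ((*v) ?D) \<le> L * R powr \<alpha>" using ball[OF \<theta>] by simp
  qed
  have fix_iff: "g \<theta> = \<theta> \<longleftrightarrow> f \<theta> = 0" for \<theta>
    using matrix_inv_mult_vec_eq_0_iff[OF assms(4)] by (simp add: g_def A_def)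
  have "\<exists>!\<theta>\<in>?B. g \<theta> = \<theta>"
  proof (rule ex1_fixpoint_cball[where c = "1/3"])
    show "norm (g x - g y) \<le> 1/3 * norm (x - y)" if "x \<in> ?B" "y \<in> ?B" for x y
      using lip[OF that] third by (meson mult_right_mono norm_ge_zero order_trans)
    \<comment> \<open>Equality holds here: both sides are \<open>r\<close>, which is why the radius
      is 3/2 times \<open>r\<close>.\<close>
    show "norm (g \<theta>\<^sub>0 - \<theta>\<^sub>0) \<le> (1 - 1/3) * R" by (simp add: g_def R_def r_def)
  qed auto
  then obtain z where z: "z \<in> ?B" "f z = 0" and uniq: "\<And>\<theta>. \<theta> \<in> ?B \<Longrightarrow> f \<theta> = 0 \<Longrightarrow> \<theta> = z"
    unfolding fix_iff by blast
  \<comment> \<open>\<open>z\<close> is fixed by \<open>g\<close>, while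
    \<open>g \<theta>\<^sub>0\<close> is the first Newton iterate
    \<open>\<theta>\<^sub>0 - A *v f \<theta>\<^sub>0\<close>.\<close>
  have "norm (z - \<theta>\<^sub>0 + A *v f \<theta>\<^sub>0) = norm (g z - g \<theta>\<^sub>0)"
    using z by (simp add: g_def algebra_simps)
  also have "\<dots> \<le> L * R powr \<alpha> * norm (z - \<theta>\<^sub>0)"
    using lip[OF z(1)] R0 by simp
  also have "\<dots> \<le> L * R powr \<alpha> * R"
    using z(1) assms(5) by (intro mult_left_mono) (auto simp: dist_norm norm_minus_commute)
  also have "\<dots> = L * R powr (1 + \<alpha>)"
    using R0 by (simp add: powr_mult_base mult_ac)
  also have "\<dots> = (3/2) powr (1 + \<alpha>) * L * r powr (1 + \<alpha>)"
    unfolding R_def r_def by (subst powr_mult) auto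
  finally have "norm (z - \<theta>\<^sub>0 + A *v f \<theta>\<^sub>0) \<le> (3/2) powr (1 + \<alpha>) * L * r powr (1 + \<alpha>)" .
  with z uniq ball show ?thesis
    unfolding A_def[symmetric] r_def[symmetric] R_def[symmetric] by blast
qed

end
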